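(* Let $\Delta\in[0,1-|\mathcal{W}|^{-1}]$ and define $$h^\star_{\mathrm{gum},\Delta}(r)=\log\left(\Big\lfloor\tfrac{1}{1-\Delta}\Big\rfloor\, r^{\frac{\Delta}{1-\Delta}}+r^{\frac{\widetilde\Delta}{1-\widetilde\Delta}}\right),\quad r\in[0,1],\qquad \widetilde\Delta=(1-\Delta)\Big\lfloor\tfrac1{1-\Delta}\Big\rfloor .$$ Then $h^\star_{\mathrm{gum},\Delta}$ gives the optimal $\mathcal{P}_\Delta$-efficiency rate for the Gumbel-max watermark: $$R_{\mathcal{P}_\Delta}(h^\star_{\mathrm{gum},\Delta})\ \ge\ R_{\mathcal{P}_\Delta}(h)$$ for every measurable function $h$ with $\mathbb{E}_0|h(Y)|<\infty$. Moreover, $R_{\mathcal{P}_\Delta}(h^\star_{\mathrm{gum},\Delta})$ is attained at the least-favorable NTP distribution $$\boldsymbol{P}^\star_\Delta=\Big(\underbrace{1-\Delta,\dots,1-\Delta}_{\lfloor\frac1{1-\Delta}\rfloor\text{ times}},\ 1-(1-\Delta)\Big\lfloor\tfrac1{1-\Delta}\Big\rfloor,\ 0,\dots\Big)\in\mathcal{P}_\Delta,$$ meaning that $R_{\mathcal{P}_\Delta}(h^\star_{\mathrm{gum},\Delta})=R_{\{\boldsymbol{P}^\star_\Delta\}}(h^\star_{\mathrm{gum},\Delta})$ and that $(h^\star_{\mathrm{gum},\Delta},\boldsymbol{P}^\star_\Delta)$ is a saddle point of the minimax problem $\min_h\max_{\boldsymbol{P}\in\mathcal{P}_\Delta}L(h,\boldsymbol{P})$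 with $L(h,\boldsymbol{P})=\mathbb{E}_0h(Y)+\log\mathbb{E}_{1,\boldsymbol{P}}e^{-h(Y)}$, i.e. $$L(h^\star_{\mathrm{gum},\Delta},\boldsymbol{P})\le L(h^\star_{\mathrm{gum},\Delta},\boldsymbol{P}^\star_\Delta)\le L(h,\boldsymbol{P}^\star_\Delta)$$ for all $\boldsymbol{P}\in\mathcal{P}_\Delta$ and all measurable $h$ with $\mathbb{E}_0|h(Y)|<\infty$.
   Context: $\mathcal{W}$ is a finite vocabulary, $|\mathcal{W}|\ge2$; an NTP distribution is a probability vector $\boldsymbol{P}=(P_w)_{w\in\mathcal{W}}$. The $\Delta$-regular class is $\mathcal{P}_\Delta=\{\boldsymbol{P}:\max_{w}P_w\le1-\Delta\}$. In the Gumbel-max watermark the pseudorandom variable is a vector $(U_w)_{w\in\mathcal{W}}$ of i.i.d. uniform $U(0,1)$ variables, the selected token is $\arg\max_{w}\frac{\log U_w}{P_w}$, and the pivotal statistic $Y$ is $U_w$ at the selected token $w$. Under $H_0$ its law $\mu_0$ is uniform on $[0,1]$; under $H_1$ with NTP distribution $\boldsymbol{P}$ its law $\mu_{1,\boldsymbol{P}}$ has CDF $F_{1,\boldsymbol{P}}(r)=\sum_{w\in\mathcal{W}}P_w r^{1/P_w}$, $r\in[0,1]$ (terms with $P_w=0$ are $0$). $\mathbb{E}_0$ and $\mathbb{E}_{1,\boldsymbol{P}}$ are expectations with $Y\sim\mu_0$ and $Y\sim\mu_{1,\boldsymbol{P}}$. For a class $\mathcal{P}$ of NTP distributions and a score function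 $h$, the $\mathcal{P}$-efficiency rate is $$R_{\mathcal{P}}(h)=-\inf_{\theta\ge0}\sup_{\boldsymbol{P}\in\mathcal{P}}\big(\theta\,\mathbb{E}_0h(Y)+\log\mathbb{E}_{1,\boldsymbol{P}}e^{-\theta h(Y)}\big),$$ where the exponential moment may be $+\infty$. Conventions: when $\widetilde\Delta=1$ the exponent $\widetilde\Delta/(1-\widetilde\Delta)$ is $+\infty$ and $r^{\infty}:=0$; $\log 0=-\infty$ (values at the single point $r=0$ are irrelevant); $\boldsymbol{P}^\star_\Delta$ is a vector of length $|\mathcal{W}|$ (if $\lfloor1/(1-\Delta)\rfloor=|\mathcal{W}|$ the remaining zero entries are dropped). *)

theory Defs
  imports "HOL-Probability.Probability"
begin

text \<open>
  The vocabulary is a finite type \<open>'w\<close>; a next-token-prediction (NTP) distribution is a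
  probability vector indexed by \<open>'w\<close>.
\<close>

definition ntp_dist :: "('w::finite \<Rightarrow> real) \<Rightarrow> bool" where
  "ntp_dist P \<longleftrightarrow> (\<forall>w. 0 \<le> P w) \<and> (\<Sum>w\<in>UNIV. P w) = 1"

definition regular_class :: "real \<Rightarrow> ('w::finite \<Rightarrow> real) set" where
  "regular_class \<Delta> = {P. ntp_dist P \<and> Max (range P) \<le> 1 - \<Delta>}"

definition unif01 :: "real measure" where
  "unif01 = uniform_measure lborel {0..1}"

text \<open>
  For \<open>P w = 0\<close> the quotient \<open>log U\<^sub>w / P\<^sub>w\<close> means \<open>-\<infinity>\<close>, so such a token is never selected;
  since division by zero is zero in HOL, these tokens are excluded explicitly.
  Ties, and the event that some \<open>U\<^sub>w\<close> is \<open>0\<close>, have probability zero.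
\<close>

definition gumbel_token :: "('w::finite \<Rightarrow> real) \<Rightarrow> ('w \<Rightarrow> real) \<Rightarrow> 'w" where
  "gumbel_token P U = arg_max (\<lambda>w. ln (U w) / P w) (\<lambda>w. 0 < P w)"

definition pivot :: "('w::finite \<Rightarrow> real) \<Rightarrow> ('w \<Rightarrow> real) \<Rightarrow> real" where
  "pivot P U = U (gumbel_token P U)"

definition mu0 :: "real measure" where
  "mu0 = unif01"

text \<open>
  The law of the pivotal statistic for i.i.d. uniform \<open>U\<^sub>w\<close>.  For an NTP distribution \<open>P\<close> its
  distribution function on \<open>[0,1]\<close> is the sum of \<open>P\<^sub>w r\<^bsup>1/P\<^sub>w\<^esup>\<close> over the \<open>w\<close> with \<open>P\<^sub>w > 0\<close>.
\<close>

definition mu1 :: "('w::finite \<Rightarrow> real) \<Rightarrow> real measure" where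
  "mu1 P = distr (PiM UNIV (\<lambda>_::'w. unif01)) borel (pivot P)"

definition elog :: "ennreal \<Rightarrow> ereal" where
  "elog x = (if x = 0 then -\<infinity> else if x = \<infinity> then \<infinity> else ereal (ln (enn2real x)))"

definition score :: "(real \<Rightarrow> real) \<Rightarrow> bool" where
  "score h \<longleftrightarrow> h \<in> borel_measurable borel \<and> integrable mu0 h"

definition loss :: "(real \<Rightarrow> real) \<Rightarrow> ('w::finite \<Rightarrow> real) \<Rightarrow> ereal" where
  "loss h P = ereal (\<integral>y. h y \<partial>mu0) + elog (\<integral>\<^sup>+y. ennreal (exp (- h y)) \<partial>mu1 P)"

definition eff_rate :: "('w::finite \<Rightarrow> real) set \<Rightarrow> (real \<Rightarrow> real) \<Rightarrow> ereal" where
  "eff_rate \<P> h =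
     - (INF \<theta>\<in>{0..}. SUP P\<in>\<P>.
          ereal (\<theta> * (\<integral>y. h y \<partial>mu0)) + elog (\<integral>\<^sup>+y. ennreal (exp (- \<theta> * h y)) \<partial>mu1 P))"

definition Delta_tilde :: "real \<Rightarrow> real" where
  "Delta_tilde \<Delta> = (1 - \<Delta>) * of_int \<lfloor>1 / (1 - \<Delta>)\<rfloor>"

text \<open>
  The second summand is \<open>r\<^bsup>\<infinity>\<^esup> = 0\<close> when \<open>Delta_tilde \<Delta> = 1\<close>.  The value at the single
  point \<open>r = 0\<close> is immaterial (HOL gives \<open>0\<close> there instead of \<open>-\<infinity>\<close>).
\<close>

definition h_gum :: "real \<Rightarrow> real \<Rightarrow> real" where
  "h_gum \<Delta> r =
     ln (of_int \<lfloor>1 / (1 - \<Delta>)\<rfloor> * r powr (\<Delta> / (1 - \<Delta>))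
         + (if Delta_tilde \<Delta> = 1 then 0
            else r powr (Delta_tilde \<Delta> / (1 - Delta_tilde \<Delta>))))"

text \<open>
  The vector \<open>P\<^sup>\<star>\<close> lists entries in order; \<open>e\<close> is the enumeration of the vocabulary by
  \<open>0, \<dots>, |W| - 1\<close> along which it is read.
\<close>

definition P_star :: "('w::finite \<Rightarrow> nat) \<Rightarrow> real \<Rightarrow> 'w \<Rightarrow> real" where
  "P_star e \<Delta> w =
     (let k = nat \<lfloor>1 / (1 - \<Delta>)\<rfloor> in
      if e w < k then 1 - \<Delta> else if e w = k then 1 - (1 - \<Delta>) * real k else 0)"

end

theory Submission
  imports Defs
begin

text \<open>
  The token \<open>w\<close> wins and its variable lies in \<open>du\<close> with probability \<open>\<Prod>\<^sub>v u\<^bsup>P\<^sub>v/P\<^sub>w\<^esup> du\<close> over \<open>v \<noteq> w\<close>, so the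
  pivotal statistic has density \<open>\<Sum>\<^sub>w u\<^bsup>1/P\<^sub>w - 1\<^esup>\<close>.  Its distribution function at \<open>r\<close> is \<open>\<Sum>\<^sub>w \<psi>(P\<^sub>w)\<close> with
  \<open>\<psi>(p) = p r\<^bsup>1/p\<^esup>\<close> convex, hence it is maximal over the \<open>\<Delta>\<close>-regular class at \<open>P\<^sup>\<star>\<close>, which majorizes the class:
  the law under \<open>P\<^sup>\<star>\<close> is stochastically smallest.  The score \<open>h\<^sup>\<star>\<close> is the logarithm of the density under
  \<open>P\<^sup>\<star>\<close> and is increasing, so every exponential moment of \<open>-\<theta> h\<^sup>\<star>\<close> is largest at \<open>P\<^sup>\<star>\<close>.  On the other hand,
  Jensen's inequality (Donsker--Varadhan) says that \<open>h\<^sup>\<star>\<close> minimizes the loss at \<open>P\<^sup>\<star>\<close>.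
\<close>

subsection \<open>The law of the pivotal statistic\<close>

lemma sets_unif01 [simp, measurable_cong]: "sets unif01 = sets borel"
  by (simp add: unif01_def)

lemma space_unif01 [simp]: "space unif01 = UNIV"
  by (simp add: unif01_def)

interpretation unif01: prob_space unif01
  unfolding unif01_def by (rule prob_space_uniform_measure) auto

interpretation unif01_product: product_prob_space "\<lambda>_. unif01" I for I :: "'w set"
  by unfold_locales

text \<open>Dropping the null point \<open>0\<close> leaves only positive arguments, on which
  \<open>powr\<close> and \<open>ln\<close> have their usual meaning.\<close>

lemma nn_integral_unif01:
  assumes [measurable]: "f \<in> borel_measurable borel"
  shows "(\<integral>\<^sup>+u. f u \<partial>unif01) = (\<integral>\<^sup>+u. f u * indicator {0<..1} u \<partial>lborel)"
proof -
  have "AE u in lborel. u \<noteq> (0::real)"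
    by (rule AE_lborel_singleton)
  then have "(\<integral>\<^sup>+u. f u * indicator {0..1} u \<partial>lborel) = (\<integral>\<^sup>+u. f u * indicator {0<..1} u \<partial>lborel)"
    by (intro nn_integral_cong_AE) (auto elim!: eventually_mono split: split_indicator)
  then show ?thesis
    unfolding unif01_def by (subst nn_integral_uniform_measure) (auto simp: divide_ennreal_def)
qed

lemma emeasure_unif01_Ioo:
  assumes "0 \<le> c" "c \<le> 1"
  shows "emeasure unif01 {0<..<c} = ennreal c"
proof -
  have "{0..1} \<inter> {0<..<c} = {0<..<c}" using assms by auto
  then show ?thesis
    using assms unfolding unif01_def by (simp add: divide_ennreal_def)
qed

text \<open>The strict inequality \<open>ln (U v) / P v < ln (U w) / P w\<close> solved for
  \<open>U v\<close>: for fixed \<open>U w\<close> the event is a box in the remaining coordinates.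
  Zero-probability competitors are left unconstrained.\<close>

definition wins :: "('w::finite \<Rightarrow> real) \<Rightarrow> 'w \<Rightarrow> ('w \<Rightarrow> real) \<Rightarrow> bool" where
  "wins P w U \<longleftrightarrow> 0 < U w \<and> U w \<le> 1
     \<and> (\<forall>v. v \<noteq> w \<longrightarrow> 0 < P v \<longrightarrow> 0 < U v \<and> U v < U w powr (P v / P w))"

lemma wins_measurable [measurable]:
  "Measurable.pred (PiM UNIV (\<lambda>_::'w::finite. unif01)) (wins P w)"
  unfolding wins_def by measurable

lemma gumbel_token_eq_if_wins:
  fixes P :: "'w::finite \<Rightarrow> real"
  assumes "0 < P w" "wins P w U"
  shows "gumbel_token P U = w"
proof -
  have less: "ln (U v) / P v < ln (U w) / P w" if "v \<noteq> w" "0 < P v" for v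
  proof -
    have "ln (U v) < ln (U w powr (P v / P w))"
      using assms that by (subst ln_less_cancel_iff) (auto simp: wins_def)
    also have "\<dots> = P v / P w * ln (U w)"
      using assms by (auto simp: wins_def ln_powr)
    finally show ?thesis using assms that by (simp add: field_simps)
  qed
  show ?thesis
    unfolding gumbel_token_def arg_max_def
  proof (rule some_equality)
    show "is_arg_max (\<lambda>w. ln (U w) / P w) (\<lambda>w. 0 < P w) w"
      unfolding is_arg_max_def using assms(1) less by (metis less_asym)
  next
    fix v assume "is_arg_max (\<lambda>w. ln (U w) / P w) (\<lambda>w. 0 < P w) v"
    then show "v = w" unfolding is_arg_max_def using assms(1) less by metis
  qed
qed

text \<open>Given \<open>U w = u\<close>, independence turns the event into a product of intervals
  of lengths \<open>u powr (P v / P w)\<close>, whose exponents add up to \<open>1 / P w - 1\<close>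
  because \<open>P\<close> sums to one.\<close>

lemma emeasure_wins:
  fixes P :: "'w::finite \<Rightarrow> real"
  assumes P: "ntp_dist P" and w: "0 < P w" and A [measurable]: "A \<in> sets borel"
  shows "emeasure (PiM UNIV (\<lambda>_. unif01)) {U. wins P w U \<and> U w \<in> A}
    = (\<integral>\<^sup>+u. ennreal (u powr (1 / P w - 1)) * indicator (A \<inter> {0<..1}) u \<partial>lborel)"
proof -
  define I where "I = UNIV - {w}"
  have I: "insert w I = UNIV" "w \<notin> I" "finite I" by (auto simp: I_def)
  have nonneg: "0 \<le> P v" for v using P by (auto simp: ntp_dist_def)
  have sum_I: "(\<Sum>v\<in>I. P v / P w) = 1 / P w - 1"
  proof -
    have "sum P I = 1 - P w"
      using P by (simp add: I_def ntp_dist_def sum_diff1)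
    then show ?thesis using w by (simp add: sum_divide_distrib[symmetric] diff_divide_distrib)
  qed
  define B where "B u v = (if 0 < P v then {0<..<u powr (P v / P w)} else UNIV)" for u :: real and v
  have [measurable]: "{U. wins P w U \<and> U w \<in> A} \<in> sets (PiM UNIV (\<lambda>_. unif01))"
  proof -
    have "{U \<in> space (PiM UNIV (\<lambda>_. unif01)). wins P w U \<and> U w \<in> A} \<in> sets (PiM UNIV (\<lambda>_. unif01))"
      by measurable
    then show ?thesis by (simp add: space_PiM)
  qed
  have inner: "(\<integral>\<^sup>+x. indicator {U. wins P w U \<and> U w \<in> A} (x(w := u)) \<partial>PiM I (\<lambda>_. unif01))
      = ennreal (u powr (1 / P w - 1)) * indicator (A \<inter> {0<..1}) u" for u
  proof (cases "u \<in> A \<inter> {0<..1}")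
    case True
    have "(\<integral>\<^sup>+x. indicator {U. wins P w U \<and> U w \<in> A} (x(w := u)) \<partial>PiM I (\<lambda>_. unif01))
        = (\<integral>\<^sup>+x. indicator (Pi\<^sub>E I (B u)) x \<partial>PiM I (\<lambda>_. unif01))"
      using True
      by (intro nn_integral_cong)
        (auto simp: wins_def B_def I_def space_PiM PiE_iff indicator_def split: if_splits)
    also have "\<dots> = emeasure (PiM I (\<lambda>_. unif01)) (Pi\<^sub>E I (B u))"
      by (intro nn_integral_indicator sets_PiM_I_finite I) (auto simp: B_def)
    also have "\<dots> = (\<Prod>v\<in>I. emeasure unif01 (B u v))"
      by (rule unif01_product.emeasure_PiM[OF I(3)]) (auto simp: B_def)
    also have "\<dots> = (\<Prod>v\<in>I. ennreal (u powr (P v / P w)))"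
    proof (rule prod.cong)
      fix v
      \<comment> \<open>An unconstrained coordinate has mass 1, which agrees with
        \<open>u powr 0\<close> since \<open>u > 0\<close>.\<close>
      have "P v = 0" if "\<not> 0 < P v" using that nonneg[of v] by auto
      moreover have "u powr (P v / P w) \<le> 1"
        using True w nonneg[of v] by (intro powr_le1) auto
      ultimately show "emeasure unif01 (B u v) = ennreal (u powr (P v / P w))"
        using True unif01.emeasure_space_1 by (auto simp: B_def emeasure_unif01_Ioo)
    qed simp
    also have "\<dots> = ennreal (\<Prod>v\<in>I. u powr (P v / P w))"
      by (rule prod_ennreal) simp
    also have "(\<Prod>v\<in>I. u powr (P v / P w)) = u powr (1 / P w - 1)"
      using True unfolding sum_I[symmetric] by (subst powr_sum) (use I in auto)
    finally show ?thesis using True by (simp del: fun_upd_apply)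
  next
    case False
    then have "(x(w := u)) \<notin> {U. wins P w U \<and> U w \<in> A}" for x
      by (auto simp: wins_def)
    then show ?thesis using False by simp
  qed
  have "emeasure (PiM UNIV (\<lambda>_. unif01)) {U. wins P w U \<and> U w \<in> A}
      = (\<integral>\<^sup>+U. indicator {U. wins P w U \<and> U w \<in> A} U \<partial>PiM (insert w I) (\<lambda>_. unif01))"
    by (simp add: I(1))
  also have "\<dots> = (\<integral>\<^sup>+u. (\<integral>\<^sup>+x. indicator {U. wins P w U \<and> U w \<in> A} (x(w := u))
      \<partial>PiM I (\<lambda>_. unif01)) \<partial>unif01)"
    by (rule unif01_product.product_nn_integral_insert_rev[OF I(3,2)]) (simp add: I(1))
  also have "\<dots> = (\<integral>\<^sup>+u. ennreal (u powr (1 / P w - 1)) * indicator (A \<inter> {0<..1}) u \<partial>lborel)"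
    unfolding inner
    by (subst nn_integral_unif01)
      (auto intro!: nn_integral_cong split: split_indicator)
  finally show ?thesis .
qed

text \<open>The Hilbert choice in \<open>gumbel_token\<close> is harmless: it acts on the set of
  maximizers, a measurable map into a finite discrete space, on which every function is
  measurable.\<close>

lemma pivot_measurable [measurable]:
  fixes P :: "'w::finite \<Rightarrow> real"
  shows "pivot P \<in> borel_measurable (PiM UNIV (\<lambda>_. unif01))"
proof -
  let ?M = "PiM UNIV (\<lambda>_::'w. unif01)"
  define A where "A U = {w. is_arg_max (\<lambda>w. ln (U w) / P w) (\<lambda>w. 0 < P w) w}" for U
  have token: "gumbel_token P U = (SOME w. w \<in> A U)" for U
    by (simp add: gumbel_token_def arg_max_def A_def)
  have [measurable]: "A \<in> measurable ?M (count_space UNIV)"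
  proof (subst measurable_count_space_eq2, simp, safe)
    fix S :: "'w set"
    have "A -` {S} \<inter> space ?M = {U \<in> space ?M. \<forall>w.
        (0 < P w \<and> \<not> (\<exists>y. 0 < P y \<and> ln (U w) / P w < ln (U y) / P y)) \<longleftrightarrow> w \<in> S}"
      by (auto simp: A_def is_arg_max_def)
    also have "\<dots> \<in> sets ?M" by measurable
    finally show "A -` {S} \<inter> space ?M \<in> sets ?M" .
  qed auto
  have token_meas: "gumbel_token P \<in> measurable ?M (count_space UNIV)"
    unfolding token[abs_def] by measurable
  have "(\<lambda>U. U (gumbel_token P U)) \<in> borel_measurable ?M"
    by (rule measurable_compose_countable'[OF _ token_meas]) (auto intro: countable_finite)
  then show ?thesis by (simp add: pivot_def[abs_def])
qed

section \<open>Explicit density and distribution function of the pivotal statistic\<close>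

lemma nn_integral_powr_Ioc:
  assumes "-1 < a" "0 \<le> c"
  shows "(\<integral>\<^sup>+u. ennreal (u powr a) * indicator {0<..c} u \<partial>lborel) = ennreal (c powr (a + 1) / (a + 1))"
proof -
  have "((\<lambda>x. if x \<in> {0..c} then x powr a else 0) has_integral (c powr (a+1) / (a+1))) UNIV"
    using has_integral_powr_from_0[OF assms] by (subst has_integral_restrict_UNIV)
  then have "(\<integral>\<^sup>+u. ennreal (if u \<in> {0..c} then u powr a else 0) \<partial>lborel) = ennreal (c powr (a + 1) / (a + 1))"
    by (intro nn_integral_has_integral_lborel) auto
  moreover have "(\<integral>\<^sup>+u. ennreal (if u \<in> {0..c} then u powr a else 0) \<partial>lborel)
      = (\<integral>\<^sup>+u. ennreal (u powr a) * indicator {0<..c} u \<partial>lborel)"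
    by (intro nn_integral_cong) (auto split: split_indicator)
  ultimately show ?thesis by simp
qed

text \<open>The termwise derivative of the distribution function. Without the guard,
  \<open>1 / 0 = 0\<close> would give a token of probability zero the term
  \<open>r powr (-1)\<close>.\<close>

definition pivot_density :: "('w::finite \<Rightarrow> real) \<Rightarrow> real \<Rightarrow> real" where
  "pivot_density P r = (\<Sum>w\<in>UNIV. if 0 < P w then r powr (1 / P w - 1) else 0)"

lemma pivot_density_nonneg: "0 \<le> pivot_density P r"
  by (auto simp: pivot_density_def intro!: sum_nonneg)

lemma pivot_density_measurable [measurable]: "pivot_density P \<in> borel_measurable borel"
  unfolding pivot_density_def by measurable

lemma nn_integral_pivot_density:
  assumes [measurable]: "A \<in> sets borel"
  shows "(\<integral>\<^sup>+r. ennreal (indicator {0<..1} r * pivot_density P r) * indicator A r \<partial>lborel)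
    = (\<Sum>w | 0 < P w. \<integral>\<^sup>+u. ennreal (u powr (1 / P w - 1)) * indicator (A \<inter> {0<..1}) u \<partial>lborel)"
proof -
  have "ennreal (indicator {0<..1} r * pivot_density P r) * indicator A r
      = (\<Sum>w | 0 < P w. ennreal (r powr (1 / P w - 1)) * indicator (A \<inter> {0<..1}) r)" for r
    by (auto simp: pivot_density_def sum.If_cases sum_distrib_right[symmetric] sum_ennreal
          split: split_indicator)
  then show ?thesis by (simp only: ) (rule nn_integral_sum, measurable)
qed

text \<open>The events that \<open>w\<close> wins strictly with \<open>U w \<in> A\<close> are
  disjoint and almost surely exhaust the event \<open>pivot P U \<in> A\<close>, so their masses
  from \<open>emeasure_wins\<close> add up.\<close>

lemma mu1_eq_density:
  fixes P :: "'w::finite \<Rightarrow> real"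
  assumes P: "ntp_dist P"
  shows "mu1 P = density lborel (\<lambda>r. ennreal (indicator {0<..1} r * pivot_density P r))"
proof (rule measure_eqI)
  let ?M = "PiM UNIV (\<lambda>_::'w. unif01)"
  have M_space [simp]: "space ?M = UNIV" by (simp add: space_PiM)
  have nonneg: "0 \<le> P w" for w using P by (auto simp: ntp_dist_def)
  define E where "E A w = {U. wins P w U \<and> U w \<in> A}" for A w
  have E_sets [measurable]: "E A w \<in> sets ?M" if [measurable]: "A \<in> sets borel" for A w
  proof -
    have "{U \<in> space ?M. wins P w U \<and> U w \<in> A} \<in> sets ?M" by measurable
    then show ?thesis by (simp add: E_def)
  qed
  have disj: "disjoint_family_on (E A) {w. 0 < P w}" for A
    using gumbel_token_eq_if_wins[of P] unfolding disjoint_family_on_def E_def by blast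
  have union: "emeasure ?M (\<Union>w\<in>{w. 0 < P w}. E A w) = (\<Sum>w | 0 < P w.
      \<integral>\<^sup>+u. ennreal (u powr (1 / P w - 1)) * indicator (A \<inter> {0<..1}) u \<partial>lborel)"
    if [measurable]: "A \<in> sets borel" for A
  proof -
    have "emeasure ?M (\<Union>w\<in>{w. 0 < P w}. E A w) = (\<Sum>w | 0 < P w. emeasure ?M (E A w))"
      by (rule sum_emeasure[symmetric]) (auto simp: disj)
    then show ?thesis using emeasure_wins[OF P] by (simp add: E_def)
  qed
  \<comment> \<open>The strict winning events already have total mass \<open>\<Sum>P\<^sub>w = 1\<close>, so ties need no separate treatment.\<close>
  have "emeasure ?M (\<Union>w\<in>{w. 0 < P w}. E UNIV w) = (\<Sum>w | 0 < P w. ennreal (P w))"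
    using nn_integral_powr_Ioc[of "1 / P w - 1" 1 for w] by (subst union) (auto intro!: sum.cong)
  also have "\<dots> = ennreal (\<Sum>w | 0 < P w. P w)"
    by (rule sum_ennreal) (simp add: nonneg)
  also have "(\<Sum>w | 0 < P w. P w) = (\<Sum>w\<in>UNIV. P w)"
    by (rule sum.mono_neutral_left) (use nonneg in \<open>auto simp: not_less intro: antisym\<close>)
  finally have "emeasure ?M (\<Union>w\<in>{w. 0 < P w}. E UNIV w) = 1"
    using P by (simp add: ntp_dist_def)
  then have "AE U in ?M. U \<in> (\<Union>w\<in>{w. 0 < P w}. E UNIV w)"
    by (intro unif01_product.AE_prob_1) (simp add: measure_def)
  then have ae: "AE U in ?M. \<exists>w. 0 < P w \<and> wins P w U"
    by (rule eventually_mono) (auto simp: E_def)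
  fix A assume "A \<in> sets (mu1 P)"
  then have [measurable]: "A \<in> sets borel" by (simp add: mu1_def)
  have "emeasure (mu1 P) A = emeasure ?M (pivot P -` A)"
    by (simp add: mu1_def emeasure_distr)
  also have "\<dots> = emeasure ?M (\<Union>w\<in>{w. 0 < P w}. E A w)"
  proof (rule emeasure_eq_AE)
    show "AE U in ?M. U \<in> pivot P -` A \<longleftrightarrow> U \<in> (\<Union>w\<in>{w. 0 < P w}. E A w)"
      using ae
    proof (rule eventually_mono)
      fix U assume "\<exists>w. 0 < P w \<and> wins P w U"
      then obtain w where w: "0 < P w" "wins P w U" by blast
      have token: "gumbel_token P U = w" by (rule gumbel_token_eq_if_wins[of P, OF w])
      \<comment> \<open>At most one token wins strictly, so membership in the union reduces to
        \<open>U w \<in> A\<close> for the winner.\<close>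
      have "v = w" if "0 < P v" "wins P v U" for v
        using gumbel_token_eq_if_wins[of P, OF that] token by metis
      then have "(\<exists>v. 0 < P v \<and> wins P v U \<and> U v \<in> A) \<longleftrightarrow> U w \<in> A" using w by metis
      then show "U \<in> pivot P -` A \<longleftrightarrow> U \<in> (\<Union>w\<in>{w. 0 < P w}. E A w)"
        unfolding E_def vimage_def pivot_def mem_Collect_eq token UN_iff by simp
    qed
    show "pivot P -` A \<in> sets ?M"
      using measurable_sets[OF pivot_measurable, of A P] by simp
  qed measurable
  also have "\<dots> = emeasure (density lborel (\<lambda>r. ennreal (indicator {0<..1} r * pivot_density P r))) A"
    by (simp add: union emeasure_density nn_integral_pivot_density)
  finally show "emeasure (mu1 P) A
      = emeasure (density lborel (\<lambda>r. ennreal (indicator {0<..1} r * pivot_density P r))) A" .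
qed (simp add: mu1_def)

definition pivot_cdf :: "('w::finite \<Rightarrow> real) \<Rightarrow> real \<Rightarrow> real" where
  "pivot_cdf P r = (\<Sum>w\<in>UNIV. if 0 < P w then P w * r powr (1 / P w) else 0)"

lemma emeasure_mu1_Ioc:
  assumes P: "ntp_dist P" and s: "0 \<le> s" "s \<le> 1"
  shows "emeasure (mu1 P) {0<..s} = ennreal (pivot_cdf P s)"
proof -
  have "{0<..s} \<inter> {0<..1} = {0<..s}" using s by auto
  then have "emeasure (mu1 P) {0<..s} = (\<Sum>w | 0 < P w. \<integral>\<^sup>+u. ennreal (u powr (1 / P w - 1)) * indicator {0<..s} u \<partial>lborel)"
    by (simp add: mu1_eq_density[OF P] emeasure_density nn_integral_pivot_density)
  also have "\<dots> = (\<Sum>w | 0 < P w. ennreal (P w * s powr (1 / P w)))"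
    using nn_integral_powr_Ioc[of "1 / P w - 1" s for w] s by (auto intro!: sum.cong simp: mult.commute)
  also have "\<dots> = ennreal (\<Sum>w | 0 < P w. P w * s powr (1 / P w))"
    by (rule sum_ennreal) auto
  also have "(\<Sum>w | 0 < P w. P w * s powr (1 / P w)) = pivot_cdf P s"
    by (auto simp: pivot_cdf_def sum.If_cases)
  finally show ?thesis .
qed

subsection \<open>Stochastic comparison\<close>

text \<open>The points \<open>x\<close> and \<open>y\<close> are mirror images in the interval, so
  their convex weights are swapped; the two convexity inequalities add up.\<close>

lemma convex_on_two_point_le:
  fixes f :: "real \<Rightarrow> real"
  assumes f: "convex_on {a..b} f" and x: "a \<le> x" "x \<le> b" and y: "y = a + b - x"
  shows "f x + f y \<le> f a + f b"
proof (cases "a = b")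
  case False
  then have ab: "a < b" using x by simp
  define t where "t = (x - a) / (b - a)"
  have t: "0 \<le> t" "t \<le> 1" using ab x by (auto simp: t_def)
  have "t * (b - a) = x - a" using ab by (simp add: t_def)
  then have xt: "x = (1 - t) *\<^sub>R a + t *\<^sub>R b" "y = (1 - (1 - t)) *\<^sub>R a + (1 - t) *\<^sub>R b"
    by (simp_all add: y algebra_simps)
  have "f x \<le> (1 - t) * f a + t * f b" "f y \<le> (1 - (1 - t)) * f a + (1 - t) * f b"
    unfolding xt by (rule convex_onD[OF f]; use t ab in simp)+
  then show ?thesis by (simp add: algebra_simps)
qed (use x y in auto)

text \<open>Moving mass from a smaller to a larger piece increases the sum, so filling as many pieces of size \<open>m\<close>
  as possible is extremal.\<close>

lemma sum_convex_le_floor: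
  fixes g :: "real \<Rightarrow> real"
  assumes g: "convex_on {0..m} g" "g 0 = 0" and m: "0 < m"
    and A: "finite A" "\<And>i. i \<in> A \<Longrightarrow> p i \<in> {0..m}"
  shows "(\<Sum>i\<in>A. g (p i)) \<le> of_int \<lfloor>sum p A / m\<rfloor> * g m + g (sum p A - m * of_int \<lfloor>sum p A / m\<rfloor>)"
  using A
proof (induction A rule: finite_induct)
  case empty
  then show ?case using g by simp
next
  case (insert i A)
  define S where "S = sum p A"
  define q where "q = p i"
  define j where "j = \<lfloor>S / m\<rfloor>"
  define \<rho> where "\<rho> = S - m * of_int j"
  have q: "0 \<le> q" "q \<le> m" using insert.prems by (auto simp: q_def)
  have "of_int j \<le> S / m" "S / m < of_int j + 1" by (auto simp: j_def)
  then have \<rho>: "0 \<le> \<rho>" "\<rho> < m" using m by (auto simp: \<rho>_def field_simps)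
  have IH: "(\<Sum>i\<in>A. g (p i)) \<le> of_int j * g m + g \<rho>"
    using insert by (simp add: \<rho>_def S_def j_def)
  \<comment> \<open>A new piece \<open>q\<close> meets the remainder \<open>\<rho>\<close>. If
    together they stay below \<open>m\<close>, the pair is spread to \<open>0\<close> and
    \<open>\<rho> + q\<close>; otherwise to \<open>m\<close>, which completes another full piece,
    and \<open>\<rho> + q - m\<close>.\<close>
  have *: "of_int j * g m + g \<rho> + g q
      \<le> of_int \<lfloor>(S + q) / m\<rfloor> * g m + g (S + q - m * of_int \<lfloor>(S + q) / m\<rfloor>)"
  proof (cases "\<rho> + q < m")
    case True
    have "\<lfloor>(S + q) / m\<rfloor> = j"
      by (rule floor_unique) (use True \<rho> q m in \<open>auto simp: \<rho>_def field_simps\<close>)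
    moreover have "g \<rho> + g q \<le> g 0 + g (\<rho> + q)"
      by (rule convex_on_two_point_le[OF convex_on_subset[OF g(1)]]) (use True \<rho> q in auto)
    moreover have "S + q - m * of_int j = \<rho> + q" by (simp add: \<rho>_def)
    ultimately show ?thesis using g(2) by (metis add.assoc add_left_mono add_0)
  next
    case False
    have "\<lfloor>(S + q) / m\<rfloor> = j + 1"
      by (rule floor_unique) (use False \<rho> q m in \<open>auto simp: \<rho>_def field_simps\<close>)
    moreover have "g \<rho> + g q \<le> g (\<rho> + q - m) + g m"
      by (rule convex_on_two_point_le[OF convex_on_subset[OF g(1)]]) (use False \<rho> q in auto)
    moreover have "S + q - m * of_int (j + 1) = \<rho> + q - m" by (simp add: \<rho>_def algebra_simps)
    ultimately show ?thesis by (simp add: algebra_simps)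
  qed
  show ?case
    using IH * insert.hyps by (simp add: S_def q_def add.commute)
qed

text \<open>This is the perspective of the convex function \<open>x \<mapsto> r\<^sup>x\<close>.\<close>

lemma convex_on_cdf_summand:
  fixes r :: real
  assumes r: "0 < r" "r \<le> 1"
  shows "convex_on {0..m} (\<lambda>p. if 0 < p then p * r powr (1 / p) else 0)"
    (is "convex_on _ ?\<psi>")
proof (rule convex_on_linorderI)
  fix t x y :: real
  assume t: "0 < t" "t < 1" and xy: "x \<in> {0..m}" "y \<in> {0..m}" "x < y"
  then have y: "0 < y" by simp
  define c where "c = (1 - t) * x + t * y"
  have c: "0 < c" using t xy by (auto simp: c_def intro: add_nonneg_pos)
  have "?\<psi> c \<le> (1 - t) * ?\<psi> x + t * ?\<psi> y"
  proof (cases "x = 0")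
    \<comment> \<open>The perspective formula divides by \<open>x\<close>. Here the value at
      \<open>x\<close> is 0 and monotonicity suffices: \<open>c \<le> y\<close> and
      \<open>r \<le> 1\<close>.\<close>
    case True
    then have "c = t * y" by (simp add: c_def)
    then have "1 / y \<le> 1 / c" using t y by (simp add: field_simps)
    then have "r powr (1 / c) \<le> r powr (1 / y)" using r by (intro powr_mono') auto
    then show ?thesis using c y True \<open>c = t * y\<close> t by (simp add: mult_left_mono)
  next
    case False
    then have x: "0 < x" using xy by simp
    have exp: "r powr z = exp (z * ln r)" for z using r by (simp add: powr_def)
    \<comment> \<open>The share of \<open>y\<close> in \<open>c\<close>; with weights
      \<open>1 - s\<close> and \<open>s\<close>, \<open>1 / c\<close> is a convex combination of
      \<open>1 / x\<close> and \<open>1 / y\<close>.\<close>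
    define s where "s = t * y / c"
    have s: "0 \<le> s" "s \<le> 1" "1 - s = (1 - t) * x / c"
      using t x y c by (auto simp: s_def c_def field_simps)
    have "1 / c = (1 - s) * (1 / x) + s * (1 / y)"
      unfolding s(3) unfolding s_def using x y c by (simp add: field_simps)
    then have "r powr (1 / c) = exp ((1 - s) *\<^sub>R (1 / x * ln r) + s *\<^sub>R (1 / y * ln r))"
      unfolding exp by (simp add: algebra_simps)
    also have "\<dots> \<le> (1 - s) * exp (1 / x * ln r) + s * exp (1 / y * ln r)"
      by (rule convex_onD[OF exp_convex]) (use s in auto)
    finally have "c * r powr (1 / c) \<le> c * ((1 - s) * r powr (1 / x) + s * r powr (1 / y))"
      unfolding exp using c by (intro mult_left_mono) auto
    also have "\<dots> = (1 - t) * (x * r powr (1 / x)) + t * (y * r powr (1 / y))"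
      unfolding s(3) unfolding s_def using c by (simp add: field_simps)
    finally show ?thesis using x y c by simp
  qed
  then show "?\<psi> ((1 - t) *\<^sub>R x + t *\<^sub>R y) \<le> (1 - t) * ?\<psi> x + t * ?\<psi> y"
    by (simp only: c_def real_scaleR_def)
qed simp

text \<open>Layer-cake formula: the integrals are compared level by level, and superlevel sets of an
  antitone function are initial segments. The premise sets a half-closed interval for
  \<open>M\<close> against an open one for \<open>N\<close>, so it does not matter whether a segment
  contains its right end.\<close>

lemma nn_integral_antimono_le_if_cdf_le:
  fixes f :: "real \<Rightarrow> real"
  assumes M: "finite_measure M" "sets M = sets borel" "AE y in M. y \<in> {0<..1}"
    and N: "finite_measure N" "sets N = sets borel" "AE y in N. y \<in> {0<..1}"
    and le: "\<And>s. 0 < s \<Longrightarrow> s \<le> 1 \<Longrightarrow> emeasure M {0<..s} \<le> emeasure N {0<..<s}"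
    and f: "antimono_on {0<..1} f"
    and [measurable]: "f \<in> borel_measurable borel"
  shows "(\<integral>\<^sup>+y. ennreal (f y) \<partial>M) \<le> (\<integral>\<^sup>+y. ennreal (f y) \<partial>N)"
proof -
  define D where "D t = {y. y \<in> {0<..1} \<and> t < f y}" for t
  have layer: "(\<integral>\<^sup>+y. ennreal (f y) \<partial>L) = (\<integral>\<^sup>+t. emeasure L (D t) * indicator {0..} t \<partial>lborel)"
    if "finite_measure L" "sets L = sets borel" "AE y in L. y \<in> {0<..1}" for L :: "real measure"
  proof -
    note [measurable_cong] = that(2)
    interpret L: finite_measure L by (rule that)
    interpret pair_sigma_finite L lborel
      by unfold_locales
    have "ennreal (f y) = (\<integral>\<^sup>+t. indicator (D t) y * indicator {0..} t \<partial>lborel)" if "y \<in> {0<..1}" for y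
    proof -
      \<comment> \<open>Negative values are cut off on both sides: \<open>ennreal\<close> sends them
        to 0 and the interval of levels is empty.\<close>
      have "ennreal (f y) = (\<integral>\<^sup>+t. indicator {0..<f y} t \<partial>lborel)"
        by (cases "0 \<le> f y") (auto simp: ennreal_neg)
      also have "\<dots> = (\<integral>\<^sup>+t. indicator (D t) y * indicator {0..} t \<partial>lborel)"
        using that by (intro nn_integral_cong) (auto simp: D_def split: split_indicator)
      finally show ?thesis .
    qed
    with that(3) have "AE y in L. ennreal (f y) = (\<integral>\<^sup>+t. indicator (D t) y * indicator {0..} t \<partial>lborel)"
      by (rule eventually_mono)
    then have "(\<integral>\<^sup>+y. ennreal (f y) \<partial>L) = (\<integral>\<^sup>+y. (\<integral>\<^sup>+t. indicator (D t) y * indicator {0..} t \<partial>lborel) \<partial>L)"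
      by (rule nn_integral_cong_AE)
    also have "\<dots> = (\<integral>\<^sup>+t. (\<integral>\<^sup>+y. indicator (D t) y * indicator {0..} t \<partial>L) \<partial>lborel)"
      unfolding D_def by (rule Fubini'[symmetric]) measurable
    also have "\<dots> = (\<integral>\<^sup>+t. emeasure L (D t) * indicator {0..} t \<partial>lborel)"
    proof (intro nn_integral_cong)
      fix t :: real
      have "D t \<in> sets L" unfolding that(2) D_def by measurable
      then show "(\<integral>\<^sup>+y. indicator (D t) y * indicator {0..} t \<partial>L) = emeasure L (D t) * indicator {0..} t"
        by (subst nn_integral_multc) auto
    qed
    finally show ?thesis .
  qed
  have "emeasure M (D t) \<le> emeasure N (D t)" for t
  proof (cases "D t = {}")
    case False
    have [measurable]: "D t \<in> sets borel" unfolding D_def by measurable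
    \<comment> \<open>The segment is squeezed as
      \<open>{0<..<s} \<subseteq> D t \<subseteq> {0<..s}\<close>; the first inclusion rests on
      antitonicity.\<close>
    define s where "s = Sup (D t)"
    have bdd: "bdd_above (D t)" by (rule bdd_aboveI[of _ 1]) (auto simp: D_def)
    have s: "0 < s" "s \<le> 1"
    proof -
      obtain y where y: "y \<in> D t" using False by auto
      then show "0 < s" using cSup_upper[OF y bdd] by (auto simp: s_def D_def)
      show "s \<le> 1" unfolding s_def using False by (intro cSup_least) (auto simp: D_def)
    qed
    have "emeasure M (D t) \<le> emeasure M {0<..s}"
      using cSup_upper[OF _ bdd] by (intro emeasure_mono) (auto simp: D_def s_def M(2))
    also have "\<dots> \<le> emeasure N {0<..<s}" by (rule le) (use s in auto)
    also have "\<dots> \<le> emeasure N (D t)"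
    proof (intro emeasure_mono subsetI)
      fix y assume y: "y \<in> {0<..<s}"
      then obtain z where z: "z \<in> D t" "y < z"
        using less_cSup_iff[OF False bdd] by (auto simp: s_def)
      then have "f z \<le> f y" using f y by (auto simp: D_def monotone_on_def)
      then show "y \<in> D t" using z y by (auto simp: D_def)
    qed (simp add: N(2))
    finally show ?thesis .
  qed simp
  then show ?thesis
    unfolding layer[OF M] layer[OF N] by (intro nn_integral_mono mult_right_mono) auto
qed

lemma prob_space_mu1: "prob_space (mu1 P)"
  unfolding mu1_def by (intro prob_space.prob_space_distr prob_space_PiM unif01.prob_space_axioms) measurable

lemma sets_mu1 [simp, measurable_cong]: "sets (mu1 P) = sets borel"
  by (simp add: mu1_def)

lemma AE_mu1: "ntp_dist P \<Longrightarrow> AE y in mu1 P. y \<in> {0<..1}"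
  unfolding mu1_eq_density by (subst AE_density) (auto split: split_indicator)

text \<open>The law has a density, hence no atoms; this provides the open interval on the right in
  \<open>nn_integral_antimono_le_if_cdf_le\<close>.\<close>

lemma emeasure_mu1_Ioo:
  assumes P: "ntp_dist P" and s: "0 \<le> s" "s \<le> 1"
  shows "emeasure (mu1 P) {0<..<s} = ennreal (pivot_cdf P s)"
proof -
  have "AE y in lborel. y \<noteq> s" by (rule AE_lborel_singleton)
  then have "AE y in mu1 P. y \<noteq> s"
    unfolding mu1_eq_density[OF P] by (subst AE_density) (auto elim!: eventually_mono)
  then have "emeasure (mu1 P) {0<..<s} = emeasure (mu1 P) {0<..s}"
    by (intro emeasure_eq_AE) (auto elim!: eventually_mono)
  then show ?thesis using emeasure_mu1_Ioc[OF assms] by simp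
qed

subsection \<open>The least-favorable distribution\<close>

lemma elog_mono: "x \<le> y \<Longrightarrow> elog x \<le> elog y"
  by (cases x; cases y) (auto simp: elog_def top_unique)

locale least_favorable =
  fixes \<Delta> :: real and e :: "'w::finite \<Rightarrow> nat"
  assumes Delta_nonneg: "0 \<le> \<Delta>" and Delta_le: "\<Delta> \<le> 1 - 1 / real CARD('w)"
    and bij_e: "bij_betw e (UNIV :: 'w set) {..<CARD('w)}"
begin

text \<open>\<open>P_star\<close> splits the unit mass into \<open>k\<close> pieces of the maximal
  size \<open>m\<close> and a leftover \<open>\<rho>\<close>.\<close>

definition m :: real where "m = 1 - \<Delta>"
definition k :: nat where "k = nat \<lfloor>1 / m\<rfloor>"
definition \<rho> :: real where "\<rho> = 1 - m * real k"

lemma m_bounds: "0 < m" "m \<le> 1" "1 / real CARD('w) \<le> m"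
proof -
  have "0 < 1 / real CARD('w)" by simp
  then show "0 < m" using Delta_le unfolding m_def by linarith
qed (use Delta_nonneg Delta_le in \<open>auto simp: m_def\<close>)

lemma floor_eq_k: "\<lfloor>1 / m\<rfloor> = int k"
  using m_bounds by (simp add: k_def)

lemma Delta_tilde_eq: "Delta_tilde \<Delta> = 1 - \<rho>"
  using floor_eq_k by (simp add: Delta_tilde_def \<rho>_def m_def)

lemma k_ge_1: "1 \<le> k"
proof -
  have "1 \<le> 1 / m" using m_bounds by simp
  then show ?thesis unfolding k_def by linarith
qed

lemma rho_bounds: "0 \<le> \<rho>" "\<rho> < m"
proof -
  have "real k \<le> 1 / m" "1 / m < real k + 1"
    using floor_correct[of "1 / m"] unfolding floor_eq_k by auto
  then show "0 \<le> \<rho>" "\<rho> < m"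
    using m_bounds unfolding \<rho>_def by (auto simp: field_simps)
qed

lemma k_le_card: "k \<le> CARD('w)"
proof -
  have "1 / m \<le> real CARD('w)" using m_bounds by (simp add: field_simps)
  then show ?thesis unfolding k_def by linarith
qed

text \<open>As \<open>m \<ge> 1 / CARD('w)\<close>, the full pieces already use up the whole mass.
  This is the case in which \<open>P_star\<close> has no coordinate for the leftover.\<close>

lemma rho_eq_0_if_k_eq_card:
  assumes "k = CARD('w)"
  shows "\<rho> = 0"
proof -
  have "1 / real CARD('w) * real k \<le> m * real k"
    using m_bounds by (intro mult_right_mono) auto
  then show ?thesis using rho_bounds assms by (simp add: \<rho>_def)
qed

lemma P_star_eq: "P_star e \<Delta> w = (if e w < k then m else if e w = k then \<rho> else 0)"
  by (simp only: P_star_def Let_def m_def k_def \<rho>_def)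

lemma sum_P_star:
  assumes F: "F 0 = (0::real)"
  shows "(\<Sum>w\<in>UNIV. F (P_star e \<Delta> w)) = real k * F m + F \<rho>"
proof -
  define G where "G i = F (if i < k then m else if i = k then \<rho> else 0)" for i
  have "(\<Sum>w\<in>UNIV. F (P_star e \<Delta> w)) = (\<Sum>w\<in>UNIV. G (e w))"
    by (simp only: G_def P_star_eq)
  also have "\<dots> = (\<Sum>i<CARD('w). G i)"
    by (rule sum.reindex_bij_betw[OF bij_e])
  \<comment> \<open>Index \<open>k\<close> carries \<open>\<rho>\<close>. If it lies beyond the
    vocabulary, its term is \<open>F 0 = 0\<close>; otherwise the indices after it are dropped as
    zero terms.\<close>
  also have "\<dots> = (\<Sum>i<Suc k. G i)"
  proof (cases "k = CARD('w)")
    case True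
    then have "G k = 0" using F rho_eq_0_if_k_eq_card by (simp add: G_def)
    then show ?thesis using True by simp
  next
    case False
    then show ?thesis
      using k_le_card F by (intro sum.mono_neutral_right) (auto simp: G_def)
  qed
  also have "\<dots> = real k * F m + F \<rho>"
    by (simp add: G_def)
  finally show ?thesis .
qed

lemma ntp_dist_P_star: "ntp_dist (P_star e \<Delta>)"
  unfolding ntp_dist_def
proof (intro conjI allI)
  fix w show "0 \<le> P_star e \<Delta> w"
    using m_bounds rho_bounds by (simp add: P_star_eq)
next
  show "sum (P_star e \<Delta>) UNIV = 1"
    using sum_P_star[of "\<lambda>x. x"] by (simp add: \<rho>_def mult.commute)
qed

lemma P_star_in_regular_class: "P_star e \<Delta> \<in> regular_class \<Delta>"
proof -
  have "P_star e \<Delta> w \<le> m" for w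
    using m_bounds rho_bounds by (simp add: P_star_eq)
  then show ?thesis using ntp_dist_P_star by (auto simp: regular_class_def m_def)
qed

text \<open>Instance of \<open>sum_convex_le_floor\<close> for total mass 1: the extremal filling
  has \<open>k\<close> full pieces and remainder \<open>\<rho>\<close>, exactly the entries of
  \<open>P_star\<close>.\<close>

lemma pivot_cdf_le_P_star:
  assumes P: "P \<in> (regular_class \<Delta> :: ('w \<Rightarrow> real) set)" and r: "0 < r" "r \<le> 1"
  shows "pivot_cdf P r \<le> pivot_cdf (P_star e \<Delta>) r"
proof -
  define \<psi> where "\<psi> p = (if 0 < p then p * r powr (1 / p) else 0)" for p
  have "P w \<in> {0..m}" for w
    using P Max_ge[of "range P" "P w"] by (auto simp: regular_class_def ntp_dist_def m_def)
  have "convex_on {0..m} \<psi>"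
    using convex_on_cdf_summand[OF r] by (simp add: \<psi>_def[abs_def])
  have "(\<Sum>w\<in>UNIV. \<psi> (P w)) \<le> real k * \<psi> m + \<psi> \<rho>"
  proof -
    have "sum P UNIV = 1" using P by (simp add: regular_class_def ntp_dist_def)
    moreover have "\<psi> 0 = 0" by (simp add: \<psi>_def)
    ultimately show ?thesis
      using sum_convex_le_floor[of m \<psi> UNIV P] m_bounds(1) \<open>convex_on {0..m} \<psi>\<close> \<open>\<And>w. P w \<in> {0..m}\<close>
      by (simp add: floor_eq_k \<rho>_def[symmetric])
  qed
  also have "\<dots> = (\<Sum>w\<in>UNIV. \<psi> (P_star e \<Delta> w))"
    by (rule sum_P_star[symmetric]) (simp add: \<psi>_def)
  finally show ?thesis by (simp add: pivot_cdf_def \<psi>_def)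
qed

section \<open>The optimal score as a log-likelihood ratio\<close>

lemma pivot_density_P_star:
  "pivot_density (P_star e \<Delta>) r = real k * r powr (1 / m - 1) + (if 0 < \<rho> then r powr (1 / \<rho> - 1) else 0)"
  using sum_P_star[of "\<lambda>p. if 0 < p then r powr (1 / p - 1) else 0"] m_bounds
  by (simp add: pivot_density_def)

text \<open>A single full-piece term gives the lower bound, as \<open>k \<ge> 1\<close>; the upper
  one counts at most \<open>k + 1\<close> powers of size at most 1. Both serve the integrability of
  \<open>h_gum\<close>.\<close>

lemma pivot_density_P_star_bounds:
  assumes r: "0 < r" "r \<le> 1"
  shows "r powr (1 / m - 1) \<le> pivot_density (P_star e \<Delta>) r"
    and "pivot_density (P_star e \<Delta>) r \<le> real k + 1"
proof -
  have "1 * r powr (1 / m - 1) \<le> real k * r powr (1 / m - 1)"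
    using k_ge_1 by (intro mult_right_mono) auto
  then show "r powr (1 / m - 1) \<le> pivot_density (P_star e \<Delta>) r"
    unfolding pivot_density_P_star by (auto intro: order_trans)
  have "real k * r powr (1 / m - 1) \<le> real k * 1"
    using r m_bounds by (intro mult_left_mono powr_le1) auto
  moreover have "0 < \<rho> \<Longrightarrow> r powr (1 / \<rho> - 1) \<le> 1"
    using r rho_bounds m_bounds by (intro powr_le1) auto
  ultimately show "pivot_density (P_star e \<Delta>) r \<le> real k + 1"
    unfolding pivot_density_P_star by auto
qed

lemma pivot_density_P_star_pos: "0 < r \<Longrightarrow> r \<le> 1 \<Longrightarrow> 0 < pivot_density (P_star e \<Delta>) r"
  using pivot_density_P_star_bounds(1)[of r] by (auto intro: less_le_trans[rotated])

lemma pivot_density_P_star_mono: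
  assumes "0 < r" "r \<le> s" "s \<le> 1"
  shows "pivot_density (P_star e \<Delta>) r \<le> pivot_density (P_star e \<Delta>) s"
  unfolding pivot_density_P_star
  using assms m_bounds rho_bounds by (auto intro!: add_mono mult_left_mono powr_mono2)

text \<open>The exponents are \<open>1 / m - 1\<close> and \<open>1 / \<rho> - 1\<close>. The case
  \<open>Delta_tilde \<Delta> = 1\<close> is \<open>\<rho> = 0\<close>, where the second term is
  absent on both sides.\<close>

lemma h_gum_eq_ln: "h_gum \<Delta> r = ln (pivot_density (P_star e \<Delta>) r)"
proof -
  have "\<Delta> / (1 - \<Delta>) = 1 / m - 1" using m_bounds by (simp add: m_def field_simps)
  moreover have "(1 - \<rho>) / (1 - (1 - \<rho>)) = 1 / \<rho> - 1" if "0 < \<rho>"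
    using that by (simp add: diff_divide_distrib)
  ultimately show ?thesis
    using rho_bounds(1) unfolding h_gum_def pivot_density_P_star Delta_tilde_eq floor_eq_k[unfolded m_def]
    by (cases "0 < \<rho>") auto
qed

lemma h_gum_measurable [measurable]: "h_gum \<Delta> \<in> borel_measurable borel"
  unfolding h_gum_eq_ln by measurable

text \<open>The logarithmic singularity at 0 is dominated by a negative power of \<open>r\<close>;
  the exponent \<open>- 1 / 2\<close> is still integrable on the unit interval.\<close>

lemma score_h_gum: "score (h_gum \<Delta>)"
  unfolding score_def mu0_def
proof (intro conjI integrableI_bounded)
  define a where "a = 1 / m - 1"
  \<comment> \<open>The part \<open>k + 1\<close> bounds \<open>ln (k + 1)\<close> from above;
    \<open>2 * a\<close> comes from \<open>- ln r \<le> 2 * r powr (- 1 / 2)\<close> in the lower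
    bound.\<close>
  define C where "C = real k + 1 + 2 * a"
  have a: "0 \<le> a" using m_bounds by (simp add: a_def)
  then have C: "0 \<le> C" by (simp add: C_def)
  have bound: "\<bar>h_gum \<Delta> r\<bar> \<le> C * r powr (- 1 / 2)" if r: "0 < r" "r \<le> 1" for r
  proof -
    have one: "1 \<le> r powr (- 1 / 2)"
      using powr_mono'[of "- 1 / 2" 0 r] r by simp
    have "h_gum \<Delta> r \<le> ln (real k + 1)"
      unfolding h_gum_eq_ln
      using pivot_density_P_star_pos[OF r] pivot_density_P_star_bounds(2)[OF r] by (subst ln_le_cancel_iff) auto
    also have "\<dots> \<le> real k + 1" using ln_bound[of "real k + 1"] by simp
    also have "\<dots> \<le> C" using a by (simp add: C_def)
    also have "\<dots> \<le> C * r powr (- 1 / 2)" using one C mult_left_mono by fastforce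
    finally have upper: "h_gum \<Delta> r \<le> C * r powr (- 1 / 2)" .
    have "- (1 / 2) * ln r = ln (r powr (- 1 / 2))" using r by (simp add: ln_powr)
    also have "\<dots> \<le> r powr (- 1 / 2)" using r by (intro ln_bound) auto
    finally have "- ln r \<le> 2 * r powr (- 1 / 2)" by simp
    then have "a * (- ln r) \<le> a * (2 * r powr (- 1 / 2))"
      using a by (intro mult_left_mono) auto
    also have "\<dots> \<le> C * r powr (- 1 / 2)"
      unfolding C_def by (simp add: algebra_simps)
    finally have "- (C * r powr (- 1 / 2)) \<le> a * ln r" by linarith
    also have "\<dots> = ln (r powr a)" using r by (simp add: ln_powr)
    also have "\<dots> \<le> h_gum \<Delta> r"
      unfolding h_gum_eq_ln a_def
      using pivot_density_P_star_pos[OF r] pivot_density_P_star_bounds(1)[OF r] r by (subst ln_le_cancel_iff) auto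
    finally show ?thesis using upper by auto
  qed
  have "(\<integral>\<^sup>+r. norm (h_gum \<Delta> r) \<partial>unif01)
      = (\<integral>\<^sup>+r. ennreal (norm (h_gum \<Delta> r)) * indicator {0<..1} r \<partial>lborel)"
    by (rule nn_integral_unif01) measurable
  also have "\<dots> \<le> (\<integral>\<^sup>+r. ennreal C * (ennreal (r powr (- 1 / 2)) * indicator {0<..1} r) \<partial>lborel)"
    using bound C
    by (intro nn_integral_mono) (auto simp: ennreal_mult[symmetric] split: split_indicator intro!: ennreal_leI)
  also have "\<dots> = ennreal C * ennreal 2"
    using nn_integral_powr_Ioc[of "- 1 / 2" 1] by (subst nn_integral_cmult) auto
  also have "\<dots> < \<infinity>" by (simp add: ennreal_mult_less_top)
  finally show "(\<integral>\<^sup>+r. norm (h_gum \<Delta> r) \<partial>unif01) < \<infinity>" .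
qed measurable

text \<open>Change of measure: on the half-open unit interval \<open>exp (h_gum \<Delta> y)\<close>
  is the likelihood ratio of \<open>mu1 (P_star e \<Delta>)\<close> to \<open>mu0\<close>.\<close>

lemma nn_integral_mu1_P_star:
  assumes [measurable]: "h \<in> borel_measurable borel"
  shows "(\<integral>\<^sup>+y. ennreal (exp (- h y)) \<partial>mu1 (P_star e \<Delta>))
    = (\<integral>\<^sup>+y. ennreal (exp (h_gum \<Delta> y - h y)) \<partial>mu0)"
proof -
  have "(\<integral>\<^sup>+y. ennreal (exp (- h y)) \<partial>mu1 (P_star e \<Delta>))
      = (\<integral>\<^sup>+y. ennreal (indicator {0<..1} y * pivot_density (P_star e \<Delta>) y) * ennreal (exp (- h y)) \<partial>lborel)"
    unfolding mu1_eq_density[OF ntp_dist_P_star] by (rule nn_integral_density) measurable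
  also have "\<dots> = (\<integral>\<^sup>+y. ennreal (exp (h_gum \<Delta> y - h y)) * indicator {0<..1} y \<partial>lborel)"
    using pivot_density_P_star_pos
    by (intro nn_integral_cong)
      (auto simp: h_gum_eq_ln exp_diff exp_minus ennreal_mult[symmetric] divide_inverse pivot_density_nonneg
        split: split_indicator)
  also have "\<dots> = (\<integral>\<^sup>+y. ennreal (exp (h_gum \<Delta> y - h y)) \<partial>mu0)"
    unfolding mu0_def by (rule nn_integral_unif01[symmetric]) measurable
  finally show ?thesis .
qed

section \<open>Saddle point and efficiency rates\<close>

lemma loss_h_gum_P_star: "loss (h_gum \<Delta>) (P_star e \<Delta>) = ereal (\<integral>y. h_gum \<Delta> y \<partial>mu0)"
  using unif01.emeasure_space_1
  by (simp add: loss_def nn_integral_mu1_P_star elog_def mu0_def)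

text \<open>Jensen's inequality under \<open>mu0\<close> bounds the mean of
  \<open>d = h_gum \<Delta> - h\<close> by the logarithm of the mean of \<open>exp d\<close>; adding
  the mean of \<open>h\<close> to both sides gives the two losses.\<close>

lemma loss_h_gum_P_star_le:
  assumes h: "score h"
  shows "loss (h_gum \<Delta>) (P_star e \<Delta>) \<le> loss h (P_star e \<Delta>)"
proof -
  have [measurable]: "h \<in> borel_measurable borel" and int_h: "integrable unif01 h"
    using h by (auto simp: score_def mu0_def)
  have int_g: "integrable unif01 (h_gum \<Delta>)" using score_h_gum by (auto simp: score_def mu0_def)
  define d where "d y = h_gum \<Delta> y - h y" for y
  have int_d: "integrable unif01 d" unfolding d_def using int_g int_h by simp
  have E_d: "(\<integral>y. d y \<partial>unif01) = (\<integral>y. h_gum \<Delta> y \<partial>unif01) - (\<integral>y. h y \<partial>unif01)"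
    unfolding d_def using int_g int_h by simp
  define X where "X = (\<integral>\<^sup>+y. ennreal (exp (d y)) \<partial>unif01)"
  have loss: "loss h (P_star e \<Delta>) = ereal (\<integral>y. h y \<partial>unif01) + elog X"
    by (simp add: loss_def nn_integral_mu1_P_star X_def d_def mu0_def)
  have "ereal (\<integral>y. d y \<partial>unif01) \<le> elog X"
  proof (cases "X = \<infinity>")
    \<comment> \<open>Jensen's inequality is applied with \<open>exp d\<close> integrable; an
      infinite moment makes the bound trivial.\<close>
    case False
    have int_exp: "integrable unif01 (\<lambda>y. exp (d y))"
      by (rule integrableI_bounded) (use False in \<open>auto simp: X_def d_def less_top\<close>)
    have "exp (\<integral>y. d y \<partial>unif01) \<le> (\<integral>y. exp (d y) \<partial>unif01)"
      by (rule unif01.jensens_inequality[where I = UNIV]) (use int_d int_exp exp_convex in auto)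
    moreover have X: "X = ennreal (\<integral>y. exp (d y) \<partial>unif01)"
      unfolding X_def by (rule nn_integral_eq_integral[OF int_exp]) simp
    moreover have pos: "0 < (\<integral>y. exp (d y) \<partial>unif01)"
      using calculation(1) exp_gt_zero by (rule less_le_trans[rotated])
    ultimately show ?thesis
      by (simp add: elog_def ln_ge_iff)
  qed (simp add: elog_def)
  then have "ereal (\<integral>y. h y \<partial>unif01) + ereal (\<integral>y. d y \<partial>unif01) \<le> ereal (\<integral>y. h y \<partial>unif01) + elog X"
    by (rule add_left_mono)
  then show ?thesis unfolding loss loss_h_gum_P_star by (simp add: E_d mu0_def)
qed

text \<open>The distribution functions are ordered by \<open>pivot_cdf_le_P_star\<close>, and the
  integrand is antitone because \<open>h_gum\<close> increases on the half-open unit interval and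
  \<open>\<theta> \<ge> 0\<close>.\<close>

lemma exp_moment_le_P_star:
  assumes P: "P \<in> (regular_class \<Delta> :: ('w \<Rightarrow> real) set)" and \<theta>: "0 \<le> \<theta>"
  shows "(\<integral>\<^sup>+y. ennreal (exp (- \<theta> * h_gum \<Delta> y)) \<partial>mu1 P)
    \<le> (\<integral>\<^sup>+y. ennreal (exp (- \<theta> * h_gum \<Delta> y)) \<partial>mu1 (P_star e \<Delta>))"
proof (rule nn_integral_antimono_le_if_cdf_le)
  have nP: "ntp_dist P" using P by (simp add: regular_class_def)
  interpret p: prob_space "mu1 P" by (rule prob_space_mu1)
  interpret s: prob_space "mu1 (P_star e \<Delta>)" by (rule prob_space_mu1)
  show "finite_measure (mu1 P)" "finite_measure (mu1 (P_star e \<Delta>))" by unfold_locales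
  show "AE y in mu1 P. y \<in> {0<..1}" "AE y in mu1 (P_star e \<Delta>). y \<in> {0<..1}"
    using nP ntp_dist_P_star by (auto intro!: AE_mu1 simp del: greaterThanAtMost_iff)
  show "emeasure (mu1 P) {0<..s} \<le> emeasure (mu1 (P_star e \<Delta>)) {0<..<s}" if "0 < s" "s \<le> 1" for s
    using that pivot_cdf_le_P_star[OF P that]
    by (simp add: emeasure_mu1_Ioc[OF nP] emeasure_mu1_Ioo[OF ntp_dist_P_star] ennreal_leI)
  show "antimono_on {0<..1} (\<lambda>y. exp (- \<theta> * h_gum \<Delta> y))"
    using \<theta> pivot_density_P_star_mono pivot_density_P_star_pos
    by (auto simp: monotone_on_def h_gum_eq_ln intro!: mult_left_mono)
qed auto

lemma loss_h_gum_le_P_star: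
  assumes P: "P \<in> (regular_class \<Delta> :: ('w \<Rightarrow> real) set)"
  shows "loss (h_gum \<Delta>) P \<le> loss (h_gum \<Delta>) (P_star e \<Delta>)"
  using exp_moment_le_P_star[OF P, of 1] unfolding loss_def
  by (auto intro!: add_left_mono elog_mono)

text \<open>The maximizer \<open>P_star\<close> is the same for every
  \<open>\<theta> \<ge> 0\<close>, so the suprema agree before the infimum is taken.\<close>

lemma eff_rate_h_gum_eq:
  "eff_rate (regular_class \<Delta> :: ('w \<Rightarrow> real) set) (h_gum \<Delta>) = eff_rate {P_star e \<Delta>} (h_gum \<Delta>)"
proof -
  have "(SUP P\<in>(regular_class \<Delta> :: ('w \<Rightarrow> real) set).
      ereal (\<theta> * (\<integral>y. h_gum \<Delta> y \<partial>mu0)) + elog (\<integral>\<^sup>+y. ennreal (exp (- \<theta> * h_gum \<Delta> y)) \<partial>mu1 P))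
    = (SUP P\<in>{P_star e \<Delta>}.
      ereal (\<theta> * (\<integral>y. h_gum \<Delta> y \<partial>mu0)) + elog (\<integral>\<^sup>+y. ennreal (exp (- \<theta> * h_gum \<Delta> y)) \<partial>mu1 P))"
    if "\<theta> \<in> {0..}" for \<theta>
    using that unfolding image_insert image_empty ccpo_Sup_singleton
    by (intro antisym SUP_least SUP_upper P_star_in_regular_class add_left_mono elog_mono
        exp_moment_le_P_star) auto
  then show ?thesis unfolding eff_rate_def by (metis (no_types, lifting) INF_cong)
qed

text \<open>The factor \<open>\<theta>\<close> is absorbed into the score:
  \<open>\<theta> * h\<close> is again a score, so its loss at \<open>P_star\<close> is at least the
  saddle value, and the supremum over the class is at least that loss.\<close>

lemma eff_rate_le_h_gum:
  assumes h: "score h"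
  shows "eff_rate (regular_class \<Delta> :: ('w \<Rightarrow> real) set) h
    \<le> eff_rate (regular_class \<Delta> :: ('w \<Rightarrow> real) set) (h_gum \<Delta>)"
proof -
  let ?L = "loss (h_gum \<Delta>) (P_star e \<Delta>)"
  let ?f = "\<lambda>h \<theta> P. ereal (\<theta> * (\<integral>y. h y \<partial>mu0)) + elog (\<integral>\<^sup>+y. ennreal (exp (- \<theta> * h y)) \<partial>mu1 P)"
  have "?L \<le> (SUP P\<in>(regular_class \<Delta> :: ('w \<Rightarrow> real) set). ?f h \<theta> P)" for \<theta>
  proof -
    have "score (\<lambda>y. \<theta> * h y)" using h by (auto simp: score_def)
    then have "?L \<le> loss (\<lambda>y. \<theta> * h y) (P_star e \<Delta>)" by (rule loss_h_gum_P_star_le)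
    also have "\<dots> = ?f h \<theta> (P_star e \<Delta>)" by (simp add: loss_def)
    also have "\<dots> \<le> (SUP P\<in>(regular_class \<Delta> :: ('w \<Rightarrow> real) set). ?f h \<theta> P)"
      by (rule SUP_upper) (rule P_star_in_regular_class)
    finally show ?thesis .
  qed
  then have "?L \<le> (INF \<theta>\<in>{0..}. SUP P\<in>(regular_class \<Delta> :: ('w \<Rightarrow> real) set). ?f h \<theta> P)"
    by (intro INF_greatest)
  \<comment> \<open>The choice \<open>\<theta> = 1\<close> reaches the saddle value.\<close>
  moreover have "(INF \<theta>\<in>{0..}. SUP P\<in>{P_star e \<Delta>}. ?f (h_gum \<Delta>) \<theta> P) \<le> ?L"
    by (rule INF_lower2[of 1]) (auto simp: loss_def)
  ultimately show ?thesis
    unfolding eff_rate_h_gum_eq unfolding eff_rate_def ereal_minus_le_minus by (rule order_trans[rotated])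
qed

end

theorem theorem3p2:
  fixes \<Delta> :: real and e :: "'w::finite \<Rightarrow> nat"
  assumes "2 \<le> CARD('w)"
    and "0 \<le> \<Delta>" and "\<Delta> \<le> 1 - 1 / real CARD('w)"
    and "bij_betw e (UNIV :: 'w set) {..<CARD('w)}"
  shows "score (h_gum \<Delta>)
    \<and> (\<forall>h. score h \<longrightarrow>
          eff_rate (regular_class \<Delta> :: ('w \<Rightarrow> real) set) h
            \<le> eff_rate (regular_class \<Delta> :: ('w \<Rightarrow> real) set) (h_gum \<Delta>))
    \<and> P_star e \<Delta> \<in> regular_class \<Delta>
    \<and> eff_rate (regular_class \<Delta> :: ('w \<Rightarrow> real) set) (h_gum \<Delta>)
        = eff_rate {P_star e \<Delta>} (h_gum \<Delta>)
    \<and> (\<forall>P \<in> (regular_class \<Delta> :: ('w \<Rightarrow> real) set).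
          loss (h_gum \<Delta>) P \<le> loss (h_gum \<Delta>) (P_star e \<Delta>))
    \<and> (\<forall>h. score h \<longrightarrow> loss (h_gum \<Delta>) (P_star e \<Delta>) \<le> loss h (P_star e \<Delta>))"
proof -
  interpret least_favorable \<Delta> e using assms by unfold_locales
  show ?thesis
    using score_h_gum eff_rate_le_h_gum P_star_in_regular_class eff_rate_h_gum_eq
      loss_h_gum_le_P_star loss_h_gum_P_star_le by blast
qed

end
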